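(* Let $H = (V,E)$ be an $r$-uniform hypergraph of maximum degree $k$, where $r$ is even, and let $\lambda : V \to \{0,1\}$ be an odd charge labeling. If $r$ is fixed and $k \in o(\sqrt{|E|})$, then $T(H,\lambda)$ can be refuted in tree-like resolution in size $2^{(1-\epsilon_r)|E| + o(|E|)}$, where $\epsilon_r = (1 - 2^{-1/r})^r$.
   Context: Hypergraphs are finite; $r$-uniform means every hyperedge has exactly $r$ vertices; the degree of a vertex is the number of hyperedges containing it. For a hypergraph $H = (V,E)$ and $\lambda : V \to \{0,1\}$, the Tseitin formula $T(H,\lambda)$ has a Boolean variable $x_e$ for every hyperedge $e \in E$ and states that for every $v \in V$, $\bigoplus_{e \ni v} x_e = \lambda(v)$ (sum modulo 2). The labeling $\lambda$ is called an odd charge labeling if $\bigoplus_{v \in V}\lambda(v) = 1$; when moreover all hyperedges have even cardinality, $T(H,\lambda)$ is unsatisfiable. As a formula to be refuted, $T(H,\lambda)$ denotes its CNF representation: each vertex constraint is written as the conjunction of all clauses on the variables $x_e$, $e \ni v$, that are falsified exactly by one of the assignments violating the constraint. A tree-like resolution refutation is a resolution refutation whose underlying derivation graph is a tree. Its smallest size equals the smallest size of a decision tree for the CNF, i.e. a rooted binary tree whose inner nodes are labeled by variables, whose edges are labeled by $0/1$ (the value of the variable queried at the node they come out of), and whose leaves are labeled by clauses falsified by the partial assignment along the path from the root to the leaf. Asymptotic notation is as $|E|\to\infty$ with $r$ fixed; the $o(|E|)$ term depends only on $r$ and the function of $|E|$ bounding $k$. *)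

theory Defs
  imports
    "HOL-Library.Z2"
    "HOL-Library.Landau_Symbols"
    Complex_Main
begin

definition hypergraph :: "'v set \<Rightarrow> 'v set set \<Rightarrow> bool" where
  "hypergraph V E \<longleftrightarrow> finite V \<and> (\<forall>e\<in>E. e \<subseteq> V)"

definition r_uniform :: "nat \<Rightarrow> 'v set set \<Rightarrow> bool" where
  "r_uniform r E \<longleftrightarrow> (\<forall>e\<in>E. card e = r)"

definition incident :: "'v set set \<Rightarrow> 'v \<Rightarrow> 'v set set" where
  "incident E v = {e \<in> E. v \<in> e}"

definition vertex_degree :: "'v set set \<Rightarrow> 'v \<Rightarrow> nat" where
  "vertex_degree E v = card (incident E v)"

text \<open>Only meaningful for nonempty \<open>V\<close>; an odd charge labeling forces \<open>V\<close> to be nonempty.\<close>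

definition max_degree :: "'v set \<Rightarrow> 'v set set \<Rightarrow> nat" where
  "max_degree V E = Max (vertex_degree E ` V)"

datatype 'x literal = Pos 'x | Neg 'x

type_synonym 'x clause = "'x literal set"
type_synonym 'x cnf = "'x clause set"

fun lit_true :: "('x \<Rightarrow> bit) \<Rightarrow> 'x literal \<Rightarrow> bool" where
  "lit_true \<alpha> (Pos x) \<longleftrightarrow> \<alpha> x = 1"
| "lit_true \<alpha> (Neg x) \<longleftrightarrow> \<alpha> x = 0"

definition satisfies :: "('x \<Rightarrow> bit) \<Rightarrow> 'x cnf \<Rightarrow> bool" where
  "satisfies \<alpha> F \<longleftrightarrow> (\<forall>C\<in>F. \<exists>l\<in>C. lit_true \<alpha> l)"

text \<open>The clause on the variables \<open>X\<close> that, among the assignments to \<open>X\<close>, is falsified exactly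
  by the restriction of \<open>\<alpha>\<close> to \<open>X\<close>.\<close>

definition falsified_clause :: "'x set \<Rightarrow> ('x \<Rightarrow> bit) \<Rightarrow> 'x clause" where
  "falsified_clause X \<alpha> = (\<lambda>x. if \<alpha> x = 1 then Neg x else Pos x) ` X"

text \<open>The type \<open>bit\<close> is the field with two elements, so sums of type \<open>bit\<close> are sums modulo 2.
  The Boolean variable attached to a hyperedge is the hyperedge itself. The values of \<open>chg\<close>
  outside \<open>V\<close> play no role.\<close>

definition odd_charge :: "'v set \<Rightarrow> ('v \<Rightarrow> bit) \<Rightarrow> bool" where
  "odd_charge V chg \<longleftrightarrow> (\<Sum>v\<in>V. chg v) = 1"

definition tseitin :: "'v set \<Rightarrow> 'v set set \<Rightarrow> ('v \<Rightarrow> bit) \<Rightarrow> 'v set cnf" where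
  "tseitin V E chg =
     {falsified_clause (incident E v) \<alpha> |v \<alpha>. v \<in> V \<and> (\<Sum>e\<in>incident E v. \<alpha> e) \<noteq> chg v}"

lemma falsified_clause_true_iff:
  "(\<exists>l\<in>falsified_clause X \<alpha>. lit_true \<beta> l) \<longleftrightarrow> (\<exists>x\<in>X. \<beta> x \<noteq> \<alpha> x)"
proof -
  have "lit_true \<beta> (if \<alpha> x = 1 then Neg x else Pos x) \<longleftrightarrow> \<beta> x \<noteq> \<alpha> x" for x
    by (cases "\<alpha> x"; cases "\<beta> x") auto
  then show ?thesis unfolding falsified_clause_def by blast
qed

lemma satisfies_tseitin_iff:
  "satisfies \<beta> (tseitin V E chg) \<longleftrightarrow> (\<forall>v\<in>V. (\<Sum>e\<in>incident E v. \<beta> e) = chg v)"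
proof
  assume L: "satisfies \<beta> (tseitin V E chg)"
  show "\<forall>v\<in>V. (\<Sum>e\<in>incident E v. \<beta> e) = chg v"
  proof (rule ballI, rule ccontr)
    fix v assume "v \<in> V" "(\<Sum>e\<in>incident E v. \<beta> e) \<noteq> chg v"
    then have "falsified_clause (incident E v) \<beta> \<in> tseitin V E chg"
      unfolding tseitin_def by blast
    then have "\<exists>l\<in>falsified_clause (incident E v) \<beta>. lit_true \<beta> l"
      using L unfolding satisfies_def by blast
    then show False unfolding falsified_clause_true_iff by blast
  qed
next
  assume R: "\<forall>v\<in>V. (\<Sum>e\<in>incident E v. \<beta> e) = chg v"
  show "satisfies \<beta> (tseitin V E chg)"
    unfolding satisfies_def
  proof
    fix C assume "C \<in> tseitin V E chg"
    then obtain v \<alpha> where v: "v \<in> V" "(\<Sum>e\<in>incident E v. \<alpha> e) \<noteq> chg v"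
      and C: "C = falsified_clause (incident E v) \<alpha>"
      unfolding tseitin_def by blast
    have "\<exists>e\<in>incident E v. \<beta> e \<noteq> \<alpha> e"
    proof (rule ccontr)
      assume "\<not> ?thesis"
      then have "(\<Sum>e\<in>incident E v. \<beta> e) = (\<Sum>e\<in>incident E v. \<alpha> e)"
        by (intro sum.cong) auto
      with v R show False by simp
    qed
    then show "\<exists>l\<in>C. lit_true \<beta> l" unfolding C falsified_clause_true_iff .
  qed
qed

text \<open>In \<open>Resolve x P Q\<close> the variable \<open>x\<close> is resolved upon; it occurs positively in the
  conclusion of \<open>P\<close> and negatively in that of \<open>Q\<close>. There is no weakening rule.\<close>

datatype 'x res_tree = Input "'x clause" | Resolve 'x "'x res_tree" "'x res_tree"

fun concl :: "'x res_tree \<Rightarrow> 'x clause" where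
  "concl (Input C) = C"
| "concl (Resolve x P Q) = (concl P - {Pos x}) \<union> (concl Q - {Neg x})"

fun derivation_from :: "'x cnf \<Rightarrow> 'x res_tree \<Rightarrow> bool" where
  "derivation_from F (Input C) \<longleftrightarrow> C \<in> F"
| "derivation_from F (Resolve x P Q) \<longleftrightarrow>
     derivation_from F P \<and> derivation_from F Q \<and> Pos x \<in> concl P \<and> Neg x \<in> concl Q"

text \<open>The size of a derivation is its number of clauses, that is, of nodes of the tree.\<close>

fun num_clauses :: "'x res_tree \<Rightarrow> nat" where
  "num_clauses (Input C) = 1"
| "num_clauses (Resolve x P Q) = 1 + num_clauses P + num_clauses Q"

definition refutation :: "'x cnf \<Rightarrow> 'x res_tree \<Rightarrow> bool" where
  "refutation F P \<longleftrightarrow> derivation_from F P \<and> concl P = {}"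

definition tree_refutable_in_size :: "'x cnf \<Rightarrow> real \<Rightarrow> bool" where
  "tree_refutable_in_size F s \<longleftrightarrow> (\<exists>P. refutation F P \<and> real (num_clauses P) \<le> s)"

definition epsilon_r :: "nat \<Rightarrow> real" where
  "epsilon_r r = (1 - 2 powr (- 1 / real r)) ^ r"

end

theory Submission
  imports Defs
begin

text \<open>Fix \<open>U \<subseteq> V\<close>. Once the hyperedges meeting both \<open>U\<close> and \<open>V - U\<close> are assigned, exactly one of
  the two sides carries an odd residual charge, since every hyperedge is even; it then suffices to
  query the hyperedges inside that side. This costs \<open>2\<close> to the power \<open>|E|\<close> minus the number of
  hyperedges inside the other side. For a uniformly random \<open>U\<close> each side contains
  \<open>2\<^sup>-\<^sup>r |E|\<close> hyperedges on average, with variance at most \<open>r k |E|\<close>, because disjoint hyperedges are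
  uncorrelated. Finally \<open>\<epsilon>\<^sub>r \<le> 2\<^sup>-\<^sup>r\<close>.\<close>

section \<open>Derivations that query a set of variables\<close>

lemma falsified_clause_insert:
  "falsified_clause (insert x X) \<alpha> =
     insert (if \<alpha> x = 1 then Neg x else Pos x) (falsified_clause X \<alpha>)"
  by (simp add: falsified_clause_def)

lemma falsified_clause_cong:
  "(\<And>x. x \<in> X \<Longrightarrow> \<alpha> x = \<beta> x) \<Longrightarrow> falsified_clause X \<alpha> = falsified_clause X \<beta>"
  unfolding falsified_clause_def by (intro image_cong) auto

text \<open>If a premise does not contain the variable, it already derives a subset of the target
  clause; this makes up for the missing weakening rule.\<close>

lemma resolve_subset:
  assumes "derivation_from F P" "concl P \<subseteq> insert (Pos x) C"
    and "derivation_from F Q" "concl Q \<subseteq> insert (Neg x) C"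
  obtains R where "derivation_from F R" "concl R \<subseteq> C"
    "num_clauses R \<le> 1 + num_clauses P + num_clauses Q"
proof (cases "Pos x \<in> concl P \<and> Neg x \<in> concl Q")
  case True
  show thesis
    by (rule that[of "Resolve x P Q"]) (use True assms in auto)
next
  case False
  then consider "Pos x \<notin> concl P" | "Neg x \<notin> concl Q" by blast
  then show thesis
  proof cases
    case 1
    show thesis by (rule that[of P]) (use 1 assms in auto)
  next
    case 2
    show thesis by (rule that[of Q]) (use 2 assms in auto)
  qed
qed

text \<open>This is a complete decision tree on \<open>X\<close> with a given derivation hung at
  each leaf. The strict bound pays for the inner nodes: two trees of at most \<open>N - 1\<close>
  nodes and a root have at most \<open>2 * N - 1\<close> nodes, so each query exactly doubles the
  bound.\<close>

lemma derivation_by_querying: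
  assumes "finite X"
    and "\<And>\<alpha>. \<exists>P. derivation_from F P \<and> concl P \<subseteq> C \<union> falsified_clause X \<alpha> \<and> num_clauses P < N"
  shows "\<exists>P. derivation_from F P \<and> concl P \<subseteq> C \<and> num_clauses P < 2 ^ card X * N"
  using assms
proof (induction X arbitrary: C N rule: finite_induct)
  case empty
  then show ?case by (simp add: falsified_clause_def)
next
  case (insert x X)
  \<comment> \<open>The new variable \<open>x\<close> is queried last, just above the given
    derivations. The induction hypothesis for \<open>X\<close> then applies with
    \<open>2 * N\<close> in place of \<open>N\<close>.\<close>
  have "\<exists>P. derivation_from F P \<and> concl P \<subseteq> C \<union> falsified_clause X \<alpha> \<and> num_clauses P < 2 * N"
    for \<alpha>
  proof -
    have same: "falsified_clause X (\<alpha>(x := b)) = falsified_clause X \<alpha>" for b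
      using insert.hyps by (intro falsified_clause_cong) auto
    obtain P where P: "derivation_from F P" "num_clauses P < N"
        "concl P \<subseteq> insert (Pos x) (C \<union> falsified_clause X \<alpha>)"
      using insert.prems[of "\<alpha>(x := 0)"] unfolding falsified_clause_insert same by auto
    obtain Q where Q: "derivation_from F Q" "num_clauses Q < N"
        "concl Q \<subseteq> insert (Neg x) (C \<union> falsified_clause X \<alpha>)"
      using insert.prems[of "\<alpha>(x := 1)"] unfolding falsified_clause_insert same by auto
    obtain R where R: "derivation_from F R" "concl R \<subseteq> C \<union> falsified_clause X \<alpha>"
        "num_clauses R \<le> 1 + num_clauses P + num_clauses Q"
      using resolve_subset[OF P(1,3) Q(1,3)] .
    with P(2) Q(2) show ?thesis by (intro exI[of _ R]) simp
  qed
  from insert.IH[OF this] show ?case using insert.hyps by (simp add: mult.assoc mult.left_commute)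
qed

section \<open>Charge on the two sides of a vertex cut\<close>

text \<open>Double counting: \<gamma> e is added once for each vertex of
  \<open>e \<inter> W\<close>, and modulo 2 only the parity of that number survives.\<close>

lemma sum_incident_eq_sum_odd:
  fixes \<gamma> :: "'v set \<Rightarrow> bit"
  assumes "finite E" "finite W"
  shows "(\<Sum>v\<in>W. \<Sum>e\<in>incident E v. \<gamma> e) = (\<Sum>e | e \<in> E \<and> odd (card (e \<inter> W)). \<gamma> e)"
proof -
  have "(\<Sum>v\<in>W. \<Sum>e\<in>incident E v. \<gamma> e) = (\<Sum>e\<in>E. \<Sum>v | v \<in> W \<and> v \<in> e. \<gamma> e)"
    unfolding incident_def by (rule sum.swap_restrict[OF assms(2,1)])
  also have "\<dots> = (\<Sum>e\<in>E. if odd (card (e \<inter> W)) then \<gamma> e else 0)"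
  proof (rule sum.cong)
    fix e assume "e \<in> E"
    have "{v \<in> W. v \<in> e} = e \<inter> W" by auto
    moreover have "(of_nat n :: bit) = of_bool (odd n)" for n
      by (induction n) auto
    ultimately show "(\<Sum>v | v \<in> W \<and> v \<in> e. \<gamma> e) = (if odd (card (e \<inter> W)) then \<gamma> e else 0)"
      by simp
  qed simp
  also have "\<dots> = (\<Sum>e | e \<in> E \<and> odd (card (e \<inter> W)). \<gamma> e)"
    using assms(1) by (simp add: sum.inter_filter)
  finally show ?thesis .
qed

text \<open>Hyperedges inside \<open>W\<close> are even and cancel from the sum of the constraints
  over \<open>W\<close>. By \<open>charge\<close>, no values for them can therefore satisfy all
  these constraints, so every leaf of the query tree violates some vertex of \<open>W\<close>. The
  condition on \<open>X\<close> ensures that the violated clause mentions only hyperedges in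
  \<open>X\<close> or inside \<open>W\<close>.\<close>

lemma derivation_within_side:
  assumes "finite E" "finite V" "W \<subseteq> V"
    and even: "\<And>e. e \<in> E \<Longrightarrow> even (card e)"
    and X: "\<And>e. e \<in> E \<Longrightarrow> e \<inter> W \<noteq> {} \<Longrightarrow> \<not> e \<subseteq> W \<Longrightarrow> e \<in> X"
    and charge: "(\<Sum>v\<in>W. chg v) \<noteq> (\<Sum>e | e \<in> E \<and> odd (card (e \<inter> W)). \<alpha> e)"
  shows "\<exists>P. derivation_from (tseitin V E chg) P \<and> concl P \<subseteq> falsified_clause X \<alpha> \<and>
    num_clauses P < 2 ^ card {e \<in> E. e \<subseteq> W} * 2"
proof (rule derivation_by_querying)
  show "finite {e \<in> E. e \<subseteq> W}" using assms(1) by simp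
next
  fix \<beta> :: "'a set \<Rightarrow> bit"
  define \<gamma> where "\<gamma> e = (if e \<subseteq> W then \<beta> e else \<alpha> e)" for e
  \<comment> \<open>A hyperedge inside \<open>W\<close> meets \<open>W\<close> in all of its
    vertices, an even number, so every summand comes from a hyperedge where \<gamma> equals
    \<alpha>.\<close>
  have "(\<Sum>e | e \<in> E \<and> odd (card (e \<inter> W)). \<gamma> e) = (\<Sum>e | e \<in> E \<and> odd (card (e \<inter> W)). \<alpha> e)"
    using even by (intro sum.cong) (auto simp: \<gamma>_def Int_absorb2)
  then have "(\<Sum>v\<in>W. chg v) \<noteq> (\<Sum>v\<in>W. \<Sum>e\<in>incident E v. \<gamma> e)"
    using charge sum_incident_eq_sum_odd[OF assms(1) finite_subset[OF assms(3,2)]] by metis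
  then obtain v where v: "v \<in> W" "(\<Sum>e\<in>incident E v. \<gamma> e) \<noteq> chg v"
    by (metis (no_types, lifting) sum.cong)
  have "falsified_clause (incident E v) \<gamma> \<subseteq>
      falsified_clause X \<alpha> \<union> falsified_clause {e \<in> E. e \<subseteq> W} \<beta>"
  proof
    fix l assume "l \<in> falsified_clause (incident E v) \<gamma>"
    then obtain e where e: "e \<in> E" "v \<in> e" "l = (if \<gamma> e = 1 then Neg e else Pos e)"
      by (auto simp: falsified_clause_def incident_def)
    show "l \<in> falsified_clause X \<alpha> \<union> falsified_clause {e \<in> E. e \<subseteq> W} \<beta>"
    proof (cases "e \<subseteq> W")
      case True
      then show ?thesis using e(1,3) unfolding falsified_clause_def \<gamma>_def by simp
    next
      case False
      then have "e \<in> X" using X[OF e(1)] e(2) v(1) by blast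
      then show ?thesis using e(3) False unfolding falsified_clause_def \<gamma>_def by simp
    qed
  qed
  moreover have "falsified_clause (incident E v) \<gamma> \<in> tseitin V E chg"
    using v assms(3) unfolding tseitin_def by blast
  \<comment> \<open>Each leaf is a single input clause, whence \<open>N = 2\<close> in the strict
    bound.\<close>
  ultimately show "\<exists>P. derivation_from (tseitin V E chg) P \<and>
      concl P \<subseteq> falsified_clause X \<alpha> \<union> falsified_clause {e \<in> E. e \<subseteq> W} \<beta> \<and> num_clauses P < 2"
    by (intro exI[of _ "Input (falsified_clause (incident E v) \<gamma>)"]) simp
qed

text \<open>Two rounds of querying: first the crossing hyperedges \<open>X\<close>, then those
  inside a side with contradictory charge. The hyperedges inside the other side, at least
  \<open>s\<close> of them, are never queried on that branch.\<close>

lemma refutation_from_cut: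
  assumes H: "hypergraph V E" "\<And>e. e \<in> E \<Longrightarrow> even (card e)" "{} \<notin> E"
    and odd: "odd_charge V chg" and U: "U \<subseteq> V"
    and s: "s \<le> card {e \<in> E. e \<subseteq> U}" "s \<le> card {e \<in> E. e \<subseteq> V - U}"
  shows "\<exists>P. refutation (tseitin V E chg) P \<and> num_clauses P \<le> 2 ^ (card E - s + 1)"
proof -
  have fV: "finite V" and EV: "\<And>e. e \<in> E \<Longrightarrow> e \<subseteq> V"
    using H(1) by (auto simp: hypergraph_def)
  have fE: "finite E" using EV fV by (intro finite_subset[of E "Pow V"]) auto
  define A where "A = {e \<in> E. e \<subseteq> U}"
  define B where "B = {e \<in> E. e \<subseteq> V - U}"
  define X where "X = E - (A \<union> B)"
  \<comment> \<open>Only the empty set lies inside both sides, and it is excluded by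
    \<open>{} \<notin> E\<close>.\<close>
  have "e = {}" if "e \<in> A \<inter> B" for e using that unfolding A_def B_def by blast
  with H(3) have "A \<inter> B = {}" unfolding A_def by blast
  then have "card (A \<union> B) = card A + card B"
    using fE by (intro card_Un_disjoint) (auto simp: A_def B_def)
  moreover have "card E = card X + card (A \<union> B)"
    unfolding X_def using fE
    by (subst card_Un_disjoint[symmetric]) (auto simp: A_def B_def intro!: arg_cong[of _ _ card])
  ultimately have le: "card X + card A \<le> card E - s" "card X + card B \<le> card E - s"
    using s unfolding A_def B_def by auto
  \<comment> \<open>Which side is contradictory depends on \<alpha>, but the first round needs one
    bound for all its leaves. Multiplied by \<open>2 ^ card X\<close>, this bound gives
    \<open>2 ^ (card E - s + 1)\<close>.\<close>
  have side: "\<exists>P. derivation_from (tseitin V E chg) P \<and> concl P \<subseteq> {} \<union> falsified_clause X \<alpha> \<and>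
      num_clauses P < 2 ^ (card E - s - card X) * 2" for \<alpha>
  proof -
    have "odd (card (e \<inter> U)) \<longleftrightarrow> odd (card (e \<inter> (V - U)))" if "e \<in> E" for e
    proof -
      have fin: "finite e" using EV[OF that] fV finite_subset by auto
      have "e = (e \<inter> U) \<union> (e \<inter> (V - U))" using EV[OF that] U by auto
      then have "card e = card (e \<inter> U) + card (e \<inter> (V - U))"
        using fin by (subst card_Un_disjoint[symmetric]) auto
      then show ?thesis using H(2)[OF that] by simp
    qed
    then have same: "{e. e \<in> E \<and> odd (card (e \<inter> U))} = {e. e \<in> E \<and> odd (card (e \<inter> (V - U)))}"
      by blast
    have "(\<Sum>v\<in>U. chg v) + (\<Sum>v\<in>V - U. chg v) = 1"
      using odd U fV unfolding odd_charge_def by (metis add.commute sum.subset_diff)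
    \<comment> \<open>An even hyperedge meets both sides with the same parity, so the two right-hand
      sums coincide. If both equalities held, the total charge would be some \<open>x + x\<close>,
      which is 0 in \<open>bit\<close>.\<close>
    then consider "(\<Sum>v\<in>U. chg v) \<noteq> (\<Sum>e | e \<in> E \<and> odd (card (e \<inter> U)). \<alpha> e)"
      | "(\<Sum>v\<in>V - U. chg v) \<noteq> (\<Sum>e | e \<in> E \<and> odd (card (e \<inter> (V - U))). \<alpha> e)"
      unfolding same by fastforce
    moreover have enough: ?thesis
      if "\<exists>P. derivation_from (tseitin V E chg) P \<and> concl P \<subseteq> falsified_clause X \<alpha> \<and>
        num_clauses P < 2 ^ n * 2" and n: "n \<le> card E - s - card X" for n
    proof -
      have "(2::nat) ^ n * 2 \<le> 2 ^ (card E - s - card X) * 2"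
        using n by (intro mult_right_mono power_increasing) auto
      with that(1) show ?thesis by (metis Un_empty_left less_le_trans)
    qed
    ultimately show ?thesis
    proof cases
      case 1
      have "\<exists>P. derivation_from (tseitin V E chg) P \<and> concl P \<subseteq> falsified_clause X \<alpha> \<and>
          num_clauses P < 2 ^ card A * 2"
        unfolding A_def
        by (rule derivation_within_side[OF fE fV U H(2) _ 1]) (auto simp: X_def A_def B_def)
      then show ?thesis using le by (intro enough[of "card A"]) auto
    next
      case 2
      have "\<exists>P. derivation_from (tseitin V E chg) P \<and> concl P \<subseteq> falsified_clause X \<alpha> \<and>
          num_clauses P < 2 ^ card B * 2"
        unfolding B_def
        by (rule derivation_within_side[OF fE fV _ H(2) _ 2]) (auto simp: X_def A_def B_def)
      then show ?thesis using le by (intro enough[of "card B"]) auto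
    qed
  qed
  have "finite X" using fE by (simp add: X_def)
  from derivation_by_querying[OF this side]
  obtain P where P: "derivation_from (tseitin V E chg) P" "concl P \<subseteq> {}"
    "num_clauses P < 2 ^ card X * (2 ^ (card E - s - card X) * 2)" by blast
  have "(2::nat) ^ card X * (2 ^ (card E - s - card X) * 2) = 2 ^ (card X + (card E - s - card X) + 1)"
    by (simp add: power_add)
  also have "card X + (card E - s - card X) = card E - s" using le by simp
  finally show ?thesis using P unfolding refutation_def by (intro exI[of _ P]) auto
qed

section \<open>Second moment of the number of hyperedges inside a random vertex set\<close>

lemma card_supersets_within:
  assumes "finite V" "A \<subseteq> V"
  shows "real (card {U \<in> Pow V. A \<subseteq> U}) = 2 ^ card V / 2 ^ card A"
proof -
  have "{U \<in> Pow V. A \<subseteq> U} = (\<union>) A ` Pow (V - A)"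
  proof
    show "{U \<in> Pow V. A \<subseteq> U} \<subseteq> (\<union>) A ` Pow (V - A)"
    proof
      fix U assume "U \<in> {U \<in> Pow V. A \<subseteq> U}"
      then have "U = A \<union> (U - A)" "U - A \<in> Pow (V - A)" by auto
      then show "U \<in> (\<union>) A ` Pow (V - A)" by blast
    qed
  qed (use assms(2) in auto)
  moreover have "inj_on ((\<union>) A) (Pow (V - A))" by (rule inj_onI) blast
  ultimately have "card {U \<in> Pow V. A \<subseteq> U} = 2 ^ card (V - A)"
    using assms(1) by (simp add: card_image card_Pow)
  moreover have "card V = card (V - A) + card A"
    using assms by (metis card_Diff_subset card_mono finite_subset le_add_diff_inverse2)
  ultimately show ?thesis by (simp add: power_add)
qed

text \<open>Up to the factor \<open>2 ^ card V\<close>, the left side is the covariance of the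
  events \<open>e \<subseteq> U\<close> and \<open>f \<subseteq> U\<close> for uniform
  \<open>U\<close>. It vanishes for disjoint \<open>e\<close> and \<open>f\<close>, where
  \<open>card (e \<union> f)\<close> is \<open>2 * r\<close>; otherwise the crude bound 1 is
  enough.\<close>

lemma sum_covariance_le:
  assumes V: "finite V" and "e \<subseteq> V" "f \<subseteq> V" and r: "card e = r" "card f = r"
  shows "(\<Sum>U\<in>Pow V. (of_bool (e \<subseteq> U) - 1 / 2 ^ r) * (of_bool (f \<subseteq> U) - 1 / 2 ^ r))
    \<le> (2 ^ card V * of_bool (e \<inter> f \<noteq> {}) :: real)"
proof -
  have cnt: "(\<Sum>U\<in>Pow V. of_bool (A \<subseteq> U)) = (2 ^ card V / 2 ^ card A :: real)" if "A \<subseteq> V" for A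
  proof -
    have "(\<Sum>U\<in>Pow V. of_bool (A \<subseteq> U)) = real (card {U \<in> Pow V. A \<subseteq> U})"
      using V by (simp add: sum.inter_filter[symmetric] of_bool_def)
    then show ?thesis using card_supersets_within[OF V that] by simp
  qed
  have "(\<Sum>U\<in>Pow V. (of_bool (e \<subseteq> U) - 1 / 2 ^ r) * (of_bool (f \<subseteq> U) - 1 / 2 ^ r))
      = (\<Sum>U\<in>Pow V. of_bool (e \<union> f \<subseteq> U) - 1 / 2 ^ r * of_bool (e \<subseteq> U)
          - 1 / 2 ^ r * of_bool (f \<subseteq> U) + (1 / 2 ^ r) * (1 / 2 ^ r) :: real)"
    by (intro sum.cong) (auto simp: algebra_simps)
  also have "\<dots> = 2 ^ card V / 2 ^ card (e \<union> f) - 1 / 2 ^ r * (2 ^ card V / 2 ^ r)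
      - 1 / 2 ^ r * (2 ^ card V / 2 ^ r) + 2 ^ card V * ((1 / 2 ^ r) * (1 / 2 ^ r))"
    unfolding sum.distrib sum_subtractf sum_distrib_left[symmetric]
    using assms by (subst (1 2 3) cnt) (auto simp: card_Pow)
  also have "\<dots> = 2 ^ card V * (1 / 2 ^ card (e \<union> f) - (1 / 2 ^ r) * (1 / 2 ^ r))"
    by (simp add: algebra_simps)
  also have "\<dots> \<le> 2 ^ card V * of_bool (e \<inter> f \<noteq> {})"
  proof (rule mult_left_mono)
    have fin: "finite e" "finite f" using assms finite_subset by auto
    show "1 / 2 ^ card (e \<union> f) - (1 / 2 ^ r) * (1 / 2 ^ r) \<le> (of_bool (e \<inter> f \<noteq> {}) :: real)"
    proof (cases "e \<inter> f = {}")
      case True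
      then show ?thesis using fin r by (simp add: card_Un_disjoint power_add)
    next
      case False
      have "1 / 2 ^ card (e \<union> f) \<le> (1 :: real)" by simp
      moreover have "0 \<le> (1 / 2 ^ r) * (1 / 2 ^ r :: real)" by simp
      ultimately have "1 / 2 ^ card (e \<union> f) - (1 / 2 ^ r) * (1 / 2 ^ r) \<le> (1 :: real)" by linarith
      then show ?thesis using False by simp
    qed
  qed simp
  finally show ?thesis .
qed

lemma card_meeting_le:
  assumes "finite E" "finite e" and "\<And>v. v \<in> e \<Longrightarrow> vertex_degree E v \<le> k"
  shows "card {f \<in> E. e \<inter> f \<noteq> {}} \<le> card e * k"
proof -
  have "{f \<in> E. e \<inter> f \<noteq> {}} = (\<Union>v\<in>e. incident E v)"
    unfolding incident_def by auto
  also have "card \<dots> \<le> (\<Sum>v\<in>e. vertex_degree E v)"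
    unfolding vertex_degree_def using assms by (intro card_UN_le) auto
  also have "\<dots> \<le> card e * k"
    using sum_bounded_above[of e "vertex_degree E" k] assms(3) by simp
  finally show ?thesis .
qed

text \<open>The square expands into covariances of pairs of hyperedges. Only intersecting pairs
  contribute, and each hyperedge meets at most \<open>r * k\<close> others, itself included.\<close>

lemma sum_square_deviation_le:
  assumes H: "hypergraph V E" "r_uniform r E" and k: "\<And>v. v \<in> V \<Longrightarrow> vertex_degree E v \<le> k"
  shows "(\<Sum>U\<in>Pow V. (real (card {e \<in> E. e \<subseteq> U}) - card E / 2 ^ r)\<^sup>2)
    \<le> 2 ^ card V * (card E * (r * k))"
proof -
  have fV: "finite V" and EV: "\<And>e. e \<in> E \<Longrightarrow> e \<subseteq> V" and r: "\<And>e. e \<in> E \<Longrightarrow> card e = r"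
    using H by (auto simp: hypergraph_def r_uniform_def)
  have fE: "finite E" using EV fV by (intro finite_subset[of E "Pow V"]) auto
  \<comment> \<open>The centred indicator of \<open>e \<subseteq> U\<close>: the subtracted constant
    is the probability of that event.\<close>
  define a :: "'a set \<Rightarrow> 'a set \<Rightarrow> real" where "a U e = of_bool (e \<subseteq> U) - 1 / 2 ^ r" for U e
  have dev: "real (card {e \<in> E. e \<subseteq> U}) - card E / 2 ^ r = (\<Sum>e\<in>E. a U e)" for U
    using fE by (simp add: a_def sum_subtractf sum.inter_filter[symmetric] of_bool_def)
  have "(\<Sum>U\<in>Pow V. (real (card {e \<in> E. e \<subseteq> U}) - card E / 2 ^ r)\<^sup>2)
      = (\<Sum>U\<in>Pow V. \<Sum>e\<in>E. \<Sum>f\<in>E. a U e * a U f)"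
    unfolding dev power2_eq_square by (simp add: sum_product)
  also have "\<dots> = (\<Sum>e\<in>E. \<Sum>U\<in>Pow V. \<Sum>f\<in>E. a U e * a U f)"
    by (rule sum.swap)
  also have "\<dots> = (\<Sum>e\<in>E. \<Sum>f\<in>E. \<Sum>U\<in>Pow V. a U e * a U f)"
    by (intro sum.cong refl sum.swap)
  also have "\<dots> \<le> (\<Sum>e\<in>E. \<Sum>f\<in>E. 2 ^ card V * of_bool (e \<inter> f \<noteq> {}))"
    unfolding a_def by (intro sum_mono sum_covariance_le fV EV r)
  also have "\<dots> = (\<Sum>e\<in>E. 2 ^ card V * real (card {f \<in> E. e \<inter> f \<noteq> {}}))"
    using fE by (simp add: sum_distrib_left[symmetric] Int_def)
  also have "\<dots> \<le> (\<Sum>e\<in>E. 2 ^ card V * real (r * k))"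
  proof (intro sum_mono mult_left_mono of_nat_mono)
    fix e assume e: "e \<in> E"
    show "card {f \<in> E. e \<inter> f \<noteq> {}} \<le> r * k"
      using card_meeting_le[OF fE, of e k] r[OF e] EV[OF e] k fV finite_subset by blast
  qed simp
  finally show ?thesis by (simp add: algebra_simps)
qed

text \<open>Complementation permutes the subsets of \<open>V\<close>, so \<open>d U\<close> and
  \<open>d (V - U)\<close> have the same average. Averaging their sum yields one \<open>U\<close>
  that is good for both sides, at the price of the factor 2 under the root.\<close>

lemma balanced_cut_exists:
  assumes H: "hypergraph V E" "r_uniform r E" and k: "\<And>v. v \<in> V \<Longrightarrow> vertex_degree E v \<le> k"
  obtains U where "U \<subseteq> V"
    "card E / 2 ^ r - sqrt (2 * (card E * (r * k))) \<le> card {e \<in> E. e \<subseteq> U}"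
    "card E / 2 ^ r - sqrt (2 * (card E * (r * k))) \<le> card {e \<in> E. e \<subseteq> V - U}"
proof -
  have fV: "finite V" using H by (auto simp: hypergraph_def)
  define d where "d U = (real (card {e \<in> E. e \<subseteq> U}) - card E / 2 ^ r)\<^sup>2" for U
  have "(\<Sum>U\<in>Pow V. d (V - U)) = (\<Sum>U\<in>Pow V. d U)"
    by (rule sum.reindex_bij_witness[of _ "\<lambda>U. V - U" "\<lambda>U. V - U"]) (auto simp: double_diff)
  then have sum: "(\<Sum>U\<in>Pow V. d U + d (V - U)) \<le> 2 ^ card V * (2 * (card E * (r * k)))"
    using sum_square_deviation_le[OF assms] unfolding d_def sum.distrib by simp
  have "\<exists>U\<in>Pow V. d U + d (V - U) \<le> 2 * (card E * (r * k))"
  proof (rule ccontr)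
    assume "\<not> ?thesis"
    then have "(\<Sum>U\<in>Pow V. real (2 * (card E * (r * k)))) < (\<Sum>U\<in>Pow V. d U + d (V - U))"
      using fV by (intro sum_strict_mono) (auto simp: not_le)
    with sum fV show False by (simp add: card_Pow)
  qed
  then obtain U where U: "U \<subseteq> V" "d U + d (V - U) \<le> 2 * (card E * (r * k))" by blast
  have "0 \<le> d U" "0 \<le> d (V - U)" by (simp_all add: d_def)
  with U(2) have "d U \<le> 2 * (card E * (r * k))" "d (V - U) \<le> 2 * (card E * (r * k))" by linarith+
  then have "\<bar>card {e \<in> E. e \<subseteq> U} - card E / 2 ^ r\<bar> \<le> sqrt (2 * (card E * (r * k)))"
    "\<bar>card {e \<in> E. e \<subseteq> V - U} - card E / 2 ^ r\<bar> \<le> sqrt (2 * (card E * (r * k)))"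
    unfolding d_def by (metis real_sqrt_abs real_sqrt_le_mono)+
  then show thesis using U(1) by (intro that[of U]) (auto simp: abs_le_iff)
qed

section \<open>Numerical estimates and the final bound\<close>

text \<open>Since \<open>1 / r\<close> lies between 0 and 1, the base of the power lies between 0
  and 1/2. The fraction of hyperedges saved by a balanced cut thus covers
  \<open>epsilon_r r\<close>.\<close>

lemma epsilon_r_le:
  assumes "0 < r"
  shows "epsilon_r r \<le> 1 / 2 ^ r"
proof -
  have "(2::real) powr (-1) \<le> 2 powr (- 1 / real r)"
    using assms by (intro powr_mono) (auto simp: field_simps)
  then have "1 - 2 powr (- 1 / real r) \<le> (1 / 2 :: real)" by (simp add: powr_minus)
  moreover have "(2::real) powr (- 1 / real r) \<le> 2 powr 0"
    using assms by (intro powr_mono) auto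
  ultimately have "(1 - 2 powr (- 1 / real r)) ^ r \<le> (1 / 2 :: real) ^ r"
    by (intro power_mono) auto
  then show ?thesis by (simp add: epsilon_r_def power_one_over)
qed

lemma sqrt_mult_smallo:
  fixes \<kappa> :: "nat \<Rightarrow> real"
  assumes "\<kappa> \<in> o(\<lambda>m. real m)" "0 \<le> c"
  shows "(\<lambda>m. sqrt (c * (real m * \<bar>\<kappa> m\<bar>))) \<in> o(\<lambda>m. real m)"
proof (rule landau_o.smallI)
  fix \<delta> :: real assume \<delta>: "0 < \<delta>"
  \<comment> \<open>The square of \<delta> anticipates the root; \<open>c + 1\<close> instead of
    \<open>c\<close> keeps the quotient meaningful for \<open>c = 0\<close>.\<close>
  have "0 < \<delta>\<^sup>2 / (c + 1)" using \<delta> assms(2) by simp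
  from landau_o.smallD[OF assms(1) this]
  show "\<forall>\<^sub>F m in sequentially. norm (sqrt (c * (real m * \<bar>\<kappa> m\<bar>))) \<le> \<delta> * norm (real m)"
  proof eventually_elim
    case (elim m)
    have "c * \<bar>\<kappa> m\<bar> \<le> (c + 1) * \<bar>\<kappa> m\<bar>" by (intro mult_right_mono) auto
    also have "\<dots> \<le> (c + 1) * (\<delta>\<^sup>2 / (c + 1) * real m)"
      using elim assms(2) by (intro mult_left_mono) auto
    also have "\<dots> = \<delta>\<^sup>2 * real m" using assms(2) by (simp add: field_simps)
    finally have "real m * (c * \<bar>\<kappa> m\<bar>) \<le> real m * (\<delta>\<^sup>2 * real m)" by (intro mult_left_mono) auto
    then have "c * (real m * \<bar>\<kappa> m\<bar>) \<le> (\<delta> * real m)\<^sup>2" by (simp add: power2_eq_square algebra_simps)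
    then have "sqrt (c * (real m * \<bar>\<kappa> m\<bar>)) \<le> \<delta> * real m" using \<delta> by (intro real_le_lsqrt) auto
    then show ?case using assms(2) by simp
  qed
qed

theorem corollary5p4:
  fixes r :: nat and \<kappa> :: "nat \<Rightarrow> real"
  assumes "0 < r" and "even r"
    and "\<kappa> \<in> o(\<lambda>m. sqrt (real m))"
  shows "\<exists>g :: nat \<Rightarrow> real. g \<in> o(\<lambda>m. real m) \<and>
    (\<forall>(V :: 'v set) E chg.
       hypergraph V E \<longrightarrow> r_uniform r E \<longrightarrow> real (max_degree V E) \<le> \<kappa> (card E) \<longrightarrow>
       odd_charge V chg \<longrightarrow>
       tree_refutable_in_size (tseitin V E chg)
         (2 powr ((1 - epsilon_r r) * real (card E) + g (card E))))"
proof -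
  \<comment> \<open>This is the deviation from \<open>balanced_cut_exists\<close> with the degree
    replaced by its bound. The absolute value covers those \<open>m\<close> at which \<kappa> is
    negative. Both \<open>h\<close> and \<open>g\<close> are fixed before any hypergraph and depend
    only on \<open>r\<close> and \<kappa>.\<close>
  define h where "h m = sqrt (2 * real r * (real m * \<bar>\<kappa> m\<bar>))" for m
  \<comment> \<open>The 1 is the additive 1 in the exponent of
    \<open>refutation_from_cut\<close>.\<close>
  define g where "g m = h m + 1" for m
  have "(\<lambda>m. sqrt (real m)) \<in> O(\<lambda>m. real m)"
  proof (rule landau_o.bigI[of 1])
    have "sqrt (real m) \<le> real m" for m
      by (cases "m = 0") (auto intro!: real_le_lsqrt simp: power2_eq_square)
    then show "\<forall>\<^sub>F m in sequentially. norm (sqrt (real m)) \<le> 1 * norm (real m)"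
      by simp
  qed simp
  with assms(3) have "\<kappa> \<in> o(\<lambda>m. real m)" by (rule landau_o.small_big_trans)
  then have "h \<in> o(\<lambda>m. real m)" unfolding h_def by (rule sqrt_mult_smallo) simp
  moreover have "(\<lambda>m::nat. 1 :: real) \<in> o(\<lambda>m. real m)"
  proof (rule smalloI_tendsto)
    show "(\<lambda>m::nat. 1 / real m) \<longlonglongrightarrow> 0" by (rule lim_1_over_n)
    show "\<forall>\<^sub>F m in sequentially. real m \<noteq> 0"
      using eventually_gt_at_top[of 0] by eventually_elim simp
  qed
  ultimately have "g \<in> o(\<lambda>m. real m)" unfolding g_def by (rule sum_in_smallo)
  moreover have "tree_refutable_in_size (tseitin V E chg)
      (2 powr ((1 - epsilon_r r) * real (card E) + g (card E)))"
    if H: "hypergraph V E" "r_uniform r E" and k: "real (max_degree V E) \<le> \<kappa> (card E)"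
      and odd: "odd_charge V chg" for V :: "'v set" and E chg
  proof -
    let ?m = "card E" and ?k = "max_degree V E"
    have fV: "finite V" using H by (auto simp: hypergraph_def)
    have "vertex_degree E v \<le> ?k" if "v \<in> V" for v
      using fV that unfolding max_degree_def by simp
    from balanced_cut_exists[OF H this]
    obtain U where U: "U \<subseteq> V"
      "?m / 2 ^ r - sqrt (2 * (?m * (r * ?k))) \<le> card {e \<in> E. e \<subseteq> U}"
      "?m / 2 ^ r - sqrt (2 * (?m * (r * ?k))) \<le> card {e \<in> E. e \<subseteq> V - U}" by blast
    define s where "s = min (card {e \<in> E. e \<subseteq> U}) (card {e \<in> E. e \<subseteq> V - U})"
    have even: "even (card e)" if "e \<in> E" for e
      using H(2) assms(2) that by (simp add: r_uniform_def)
    have ne: "{} \<notin> E" using H(2) assms(1) by (auto simp: r_uniform_def)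
    obtain P where P: "refutation (tseitin V E chg) P" "num_clauses P \<le> 2 ^ (?m - s + 1)"
      using refutation_from_cut[OF H(1) even ne odd U(1), of s] by (auto simp: s_def)
    have "finite E"
      using H(1) fV by (intro finite_subset[of E "Pow V"]) (auto simp: hypergraph_def)
    then have "s \<le> ?m" unfolding s_def by (intro min.coboundedI1 card_mono) auto
    have "real r * (real ?m * real ?k) \<le> real r * (real ?m * \<bar>\<kappa> ?m\<bar>)"
      using k by (intro mult_left_mono) auto
    then have "sqrt (2 * (?m * (r * ?k))) \<le> h ?m"
      unfolding h_def by (simp add: mult_ac)
    moreover have "epsilon_r r * ?m \<le> 1 / 2 ^ r * ?m"
      using epsilon_r_le[OF assms(1)] by (intro mult_right_mono) auto
    \<comment> \<open>Both sides of the cut contain at least \<open>?m / 2 ^ r - h ?m\<close>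
      hyperedges, hence so does the smaller count \<open>s\<close>.\<close>
    ultimately have "epsilon_r r * ?m - h ?m \<le> s" using U(2,3) unfolding s_def by auto
    then have "real (?m - s + 1) \<le> (1 - epsilon_r r) * ?m + g ?m"
      using \<open>s \<le> ?m\<close> unfolding g_def by (simp add: of_nat_diff algebra_simps)
    then have "2 powr real (?m - s + 1) \<le> 2 powr ((1 - epsilon_r r) * ?m + g ?m)"
      by (intro powr_mono) auto
    moreover have "real (num_clauses P) \<le> 2 powr real (?m - s + 1)"
    proof -
      have "real (num_clauses P) \<le> real (2 ^ (?m - s + 1))"
        using P(2) by (rule of_nat_mono)
      also have "\<dots> = 2 powr real (?m - s + 1)" by (subst powr_realpow) simp_all
      finally show ?thesis .
    qed
    ultimately show ?thesis using P(1) unfolding tree_refutable_in_size_def by (meson order_trans)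
  qed
  ultimately show ?thesis by blast
qed

end
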